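(* Let $n\ge1$ and let $\mathbf{m}=(m_1,\dots,m_n)$, $\mathbf{r}=(r_1,\dots,r_n)$ be vectors of positive integers. The colored multiset Eulerian polynomial $A_{\mathbf{m}}^{\mathbf{r}}$ is symmetric with respect to its degree if and only if $$\max_{1\le k\le n}\left\lceil\frac{m_k+1}{r_k}\right\rceil\cdot r_j=m_j+1\qquad\text{for all } j\in\{1,\dots,n\}.$$
   Context: Let $m=m_1+\cdots+m_n$. A colored multiset permutation in $\mathfrak{S}_{\mathbf{m}}^{\mathbf{r}}$ is a word $\pi^{\mathbf{c}}=\pi_1^{c_1}\cdots\pi_m^{c_m}$ in which each $k\in\{1,\dots,n\}$ appears exactly $m_k$ times among $\pi_1,\dots,\pi_m$, and $1\le c_j\le r_{\pi_j}$ for all $j$. One always appends $\pi_{m+1}^{c_{m+1}}:=(n+1)^1$. Colored letters are totally ordered by $k^{c}<l^{c'}$ iff $c<c'$, or $c=c'$ and $k<l$. A descent is an index $j\in\{1,\dots,m\}$ with $\pi_j^{c_j}>\pi_{j+1}^{c_{j+1}}$, and $\mathrm{des}(\pi^{\mathbf{c}})$ is the number of descents. The colored multiset Eulerian polynomial is $A_{\mathbf{m}}^{\mathbf{r}}=\sum_{\pi^{\mathbf{c}}\in\mathfrak{S}_{\mathbf{m}}^{\mathbf{r}}}x^{\mathrm{des}(\pi^{\mathbf{c}})}$. A polynomial $p=\sum_s p_sx^s$ of degree at most $d$ is symmetric with respect to degree $d$ if $p_s=p_{d-s}$ for all $s=0,\dots,d$. *)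

theory Defs
  imports "HOL-Computational_Algebra.Polynomial"
begin

text \<open>A colored letter $k^c$ is represented by the pair \<open>(k, c)\<close>. The library order on products
  is not used, because colors are compared first.\<close>

definition letter_less :: "nat \<times> nat \<Rightarrow> nat \<times> nat \<Rightarrow> bool" where
  "letter_less a b \<longleftrightarrow> snd a < snd b \<or> (snd a = snd b \<and> fst a < fst b)"

text \<open>The vectors $\mathbf{m}$ and $\mathbf{r}$ are functions of which only the values on
  \<open>{1..n}\<close> matter.\<close>

definition colored_multiset_perms ::
    "nat \<Rightarrow> (nat \<Rightarrow> nat) \<Rightarrow> (nat \<Rightarrow> nat) \<Rightarrow> (nat \<times> nat) list set" where
  "colored_multiset_perms n m r =
     {w. length w = (\<Sum>k=1..n. m k) \<and>
         (\<forall>k\<in>{1..n}. count_list (map fst w) k = m k) \<and>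
         (\<forall>(k, c)\<in>set w. k \<in> {1..n} \<and> 1 \<le> c \<and> c \<le> r k)}"

text \<open>List positions start at 0, so position \<open>j\<close> of the extended word holds the letter
  $\pi_{j+1}^{c_{j+1}}$. The last position, \<open>length w\<close>, holds the appended letter $(n+1)^1$.\<close>

definition des :: "nat \<Rightarrow> (nat \<times> nat) list \<Rightarrow> nat" where
  "des n w = (let v = w @ [(n + 1, 1)]
              in card {j. j < length w \<and> letter_less (v ! (j + 1)) (v ! j)})"

definition colored_eulerian_poly ::
    "nat \<Rightarrow> (nat \<Rightarrow> nat) \<Rightarrow> (nat \<Rightarrow> nat) \<Rightarrow> int poly" where
  "colored_eulerian_poly n m r = (\<Sum>w\<in>colored_multiset_perms n m r. monom 1 (des n w))"

definition symmetric_wrt :: "nat \<Rightarrow> 'a::zero poly \<Rightarrow> bool" where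
  "symmetric_wrt d p \<longleftrightarrow> degree p \<le> d \<and> (\<forall>s\<in>{0..d}. coeff p s = coeff p (d - s))"

text \<open>Finiteness ensures that the sum defining the polynomial is not the default value 0.\<close>

lemma finite_colored_multiset_perms: "finite (colored_multiset_perms n m r)"
proof (rule finite_subset)
  let ?A = "Sigma {1..n} (\<lambda>k. {1..r k})"
  show "colored_multiset_perms n m r \<subseteq> {w. set w \<subseteq> ?A \<and> length w = (\<Sum>k=1..n. m k)}"
    by (auto simp: colored_multiset_perms_def)
  show "finite {w. set w \<subseteq> ?A \<and> length w = (\<Sum>k=1..n. m k)}"
    by (rule finite_lists_length_eq) auto
qed

end

theory Submission
  imports Defs "HOL-Library.Multiset" "HOL-Library.Product_Lexorder" "HOL-Library.FuncSet"
begin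

text \<open>Put $N = m_1 + \cdots + m_n$ and let $a_s$ be the coefficients of the polynomial, $d$ its degree.
  Counting multisets of triples (block, color, letter) in two ways gives
  $f(t) := \prod_k {r_k t + m_k \choose m_k} = \sum_s a_s {t + N - s \choose N}$.
  Both sides are polynomials in $t$, so
  $(-1)^N f(-t) = \prod_k {r_k t - 1 \choose m_k} = \sum_s a_s {t + s - 1 \choose N}$ for $t \ge 1$.
  The least $t \ge 1$ at which this does not vanish is the maximum $L$ of the numbers
  $\lceil (m_k + 1)/r_k \rceil$ by the product, and $N + 1 - d$ by the sum.
  At $t = L$ the value is $a_d = \prod_k {r_k L - 1 \choose m_k}$, while $a_0 = f(0) = 1$.
  Thus symmetry forces $r_k L - 1 = m_k$ for all $k$. Conversely these equations give
  $(-1)^N f(-L - t) = f(t)$, and the symmetry follows from the linear independence of the functions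
  $t \mapsto {t + N - s \choose N}$.\<close>


section \<open>Counting multisets\<close>

text \<open>Pascal's rule: a nonempty multiset over \<open>insert x A\<close> either avoids
  \<open>x\<close> or arises by adding \<open>x\<close> to a smaller one. For empty \<open>A\<close>
  the truncated subtraction still gives 1 at \<open>k = 0\<close> and 0 otherwise.\<close>

lemma multisets_of_size:
  assumes "finite A"
  shows "finite {M :: 'a multiset. set_mset M \<subseteq> A \<and> size M = k} \<and>
    card {M. set_mset M \<subseteq> A \<and> size M = k} = (card A + k - 1) choose k"
  using assms
proof (induction A arbitrary: k rule: finite_induct)
  case empty
  have eq: "{M :: 'a multiset. set_mset M \<subseteq> {} \<and> size M = k} = (if k = 0 then {{#}} else {})"
    by auto
  show ?case unfolding eq by (simp add: binomial_eq_0)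
next
  case (insert x A)
  show ?case
  proof (induction k)
    case 0
    have "{M. set_mset M \<subseteq> insert x A \<and> size M = 0} = {{#}}" by auto
    then show ?case by simp
  next
    case (Suc k)
    let ?S = "\<lambda>A k. {M. set_mset M \<subseteq> A \<and> size M = k}"
    have split: "?S (insert x A) (Suc k) = ?S A (Suc k) \<union> add_mset x ` ?S (insert x A) k"
    proof (intro equalityI subsetI)
      fix M assume M: "M \<in> ?S (insert x A) (Suc k)"
      show "M \<in> ?S A (Suc k) \<union> add_mset x ` ?S (insert x A) k"
      proof (cases "x \<in># M")
        case True
        then obtain N where "M = add_mset x N" by (meson multi_member_split)
        with M show ?thesis by auto
      qed (use M in auto)
    qed (use insert.hyps in auto)
    have disj: "?S A (Suc k) \<inter> add_mset x ` ?S (insert x A) k = {}"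
      using insert.hyps by auto
    have "card (add_mset x ` ?S (insert x A) k) = card (?S (insert x A) k)"
      by (rule card_image) (auto simp: inj_on_def)
    then have "card (?S (insert x A) (Suc k)) = (card A + k choose Suc k) + (card A + k choose k)"
      unfolding split using disj Suc.IH insert.IH[of "Suc k"] insert.hyps
      by (subst card_Un_disjoint) auto
    moreover have "finite (?S (insert x A) (Suc k))"
      unfolding split using Suc.IH insert.IH[of "Suc k"] by auto
    ultimately show ?case using insert.hyps by (simp add: add.commute)
  qed
qed

text \<open>A multiset is the sum of its restrictions to the fibres of \<open>f\<close>, and these
  can be chosen independently.\<close>

lemma card_multisets_by_key:
  assumes "finite I" "finite X"
  shows "card {M. (\<forall>x\<in>#M. x \<in> X \<and> f x \<in> I) \<and>
                  (\<forall>k\<in>I. size (filter_mset (\<lambda>x. f x = k) M) = m k)}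
    = (\<Prod>k\<in>I. (card {x \<in> X. f x = k} + m k - 1) choose m k)"
    (is "card ?L = _")
proof -
  let ?T = "\<lambda>k. {M. set_mset M \<subseteq> {x \<in> X. f x = k} \<and> size M = m k}"
  let ?split = "\<lambda>M. \<lambda>k\<in>I. filter_mset (\<lambda>x. f x = k) M"
  let ?join = "\<lambda>F. \<Sum>k\<in>I. F k"
  \<comment> \<open>The summands with index other than \<open>k\<close> contain no element of key
    \<open>k\<close>, so filtering the sum recovers \<open>F k\<close>.\<close>
  have filter_join: "filter_mset (\<lambda>x. f x = k) (?join F) = F k"
    if F: "F \<in> (\<Pi>\<^sub>E k\<in>I. ?T k)" and k: "k \<in> I" for F k
  proof (rule multiset_eqI)
    fix x
    have zero: "count (F j) x = 0" if "j \<in> I" "f x \<noteq> j" for j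
      using F that by (force simp: PiE_iff count_eq_zero_iff)
    have "(\<Sum>j\<in>I. count (F j) x) = (\<Sum>j\<in>I. if j = k then count (F j) x else 0)" if "f x = k"
      using zero that by (intro sum.cong) auto
    then show "count (filter_mset (\<lambda>x. f x = k) (?join F)) x = count (F k) x"
      using zero[OF k] k assms(1) by (auto simp: count_sum)
  qed
  have "bij_betw ?split ?L (\<Pi>\<^sub>E k\<in>I. ?T k)"
  proof (rule bij_betw_byWitness[where f' = ?join])
    show "\<forall>M\<in>?L. ?join (?split M) = M"
    proof
      fix M assume M: "M \<in> ?L"
      show "?join (?split M) = M"
      proof (rule multiset_eqI)
        fix x
        have "count (?join (?split M)) x = (\<Sum>k\<in>I. if f x = k then count M x else 0)"
          by (simp add: count_sum)
        also have "\<dots> = count M x"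
          using M assms(1) by (auto simp: not_in_iff)
        finally show "count (?join (?split M)) x = count M x" .
      qed
    qed
    show "\<forall>F\<in>(\<Pi>\<^sub>E k\<in>I. ?T k). ?split (?join F) = F"
    proof
      fix F assume F: "F \<in> (\<Pi>\<^sub>E k\<in>I. ?T k)"
      then show "?split (?join F) = F"
        using filter_join[OF F] by (auto simp: PiE_iff extensional_def fun_eq_iff)
    qed
    show "?split ` ?L \<subseteq> (\<Pi>\<^sub>E k\<in>I. ?T k)" by auto
    show "?join ` (\<Pi>\<^sub>E k\<in>I. ?T k) \<subseteq> ?L"
    proof
      fix M assume "M \<in> ?join ` (\<Pi>\<^sub>E k\<in>I. ?T k)"
      then obtain F where F: "F \<in> (\<Pi>\<^sub>E k\<in>I. ?T k)" and M: "M = ?join F" by auto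
      have "x \<in> X \<and> f x \<in> I" if "x \<in># M" for x
      proof -
        from that have "(\<Sum>k\<in>I. count (F k) x) \<noteq> 0"
          unfolding M count_sum[symmetric] by simp
        then obtain k where "k \<in> I" "count (F k) x \<noteq> 0" by (rule sum.not_neutral_contains_not_neutral)
        then have "k \<in> I" "x \<in># F k" by (simp_all add: count_eq_zero_iff)
        with F show ?thesis by (auto simp: PiE_iff)
      qed
      then show "M \<in> ?L"
        using filter_join[OF F] F M by (auto simp: PiE_iff)
    qed
  qed
  then have "card ?L = card (\<Pi>\<^sub>E k\<in>I. ?T k)" by (rule bij_betw_same_card)
  also have "\<dots> = (\<Prod>k\<in>I. card (?T k))" using assms(1) by (rule card_PiE)
  also have "\<dots> = (\<Prod>k\<in>I. (card {x \<in> X. f x = k} + m k - 1) choose m k)"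
    using assms(2) by (intro prod.cong refl multisets_of_size[THEN conjunct2]) simp
  finally show ?thesis .
qed

lemma card_sorted_lists:
  "card {l :: 'a::linorder list. sorted l \<and> P (mset l)} = card {M. P M}"
proof -
  have "bij_betw mset {l :: 'a list. sorted l \<and> P (mset l)} {M. P M}"
    by (rule bij_betw_byWitness[where f' = sorted_list_of_multiset])
      (auto simp: sorted_sort_id sorted_sorted_list_of_multiset)
  then show ?thesis by (rule bij_betw_same_card)
qed

section \<open>Descents and sorted labellings\<close>

text \<open>Hockey-stick identity; the missing terms with upper index below \<open>e\<close> vanish
  because \<open>e \<le> k\<close>.\<close>

lemma sum_choose_shift:
  assumes "e \<le> k"
  shows "(\<Sum>s<t. (s + e) choose k) = (t + e) choose Suc k"
  using assms by (induction t) (auto simp: binomial_eq_0)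

text \<open>The appended letter is a parameter so that recursion from the right works: after
  removing the last letter \<open>y\<close>, \<open>y\<close> itself becomes the appended
  letter.\<close>

definition descents :: "'a::linorder list \<Rightarrow> 'a \<Rightarrow> nat" where
  "descents w z = card {j. j < length w \<and> (w @ [z]) ! Suc j < (w @ [z]) ! j}"

lemma descents_Nil [simp]: "descents [] z = 0"
  by (simp add: descents_def)

lemma descents_snoc [simp]:
  "descents (w @ [y]) z = descents w y + (if z < y then 1 else 0)"
proof -
  let ?D = "{j. j < length w \<and> (w @ [y]) ! Suc j < (w @ [y]) ! j}"
  have "{j. j < length (w @ [y]) \<and> ((w @ [y]) @ [z]) ! Suc j < ((w @ [y]) @ [z]) ! j}
      = ?D \<union> (if z < y then {length w} else {})"
    by (auto simp: nth_append less_Suc_eq)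
  then show ?thesis by (simp add: descents_def)
qed

lemma descents_le_length: "descents w z \<le> length w"
proof -
  have "descents w z \<le> card {..<length w}"
    unfolding descents_def by (rule card_mono) auto
  then show ?thesis by simp
qed

text \<open>Sorted words over pairs encode a word together with a weakly increasing sequence of block numbers
  that increases strictly at the descents of the word.\<close>

lemma card_sorted_labellings:
  fixes w :: "'a::linorder list"
  shows "finite {l :: (nat \<times> 'a) list. sorted (l @ [(t, z)]) \<and> map snd l = w} \<and>
    card {l :: (nat \<times> 'a) list. sorted (l @ [(t, z)]) \<and> map snd l = w}
      = (t + (length w - descents w z)) choose length w"
proof (induction w arbitrary: t z rule: rev_induct)
  case Nil
  have "{l :: (nat \<times> 'a) list. sorted (l @ [(t, z)]) \<and> map snd l = []} = {[]}" by auto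
  then show ?case by simp
next
  case (snoc y w)
  let ?B = "\<lambda>w t z. {l :: (nat \<times> 'a) list. sorted (l @ [(t, z)]) \<and> map snd l = w}"
  \<comment> \<open>The last letter \<open>y\<close> may carry any block below \<open>t\<close>, and
    also \<open>t\<close> itself unless it is a descent to \<open>z\<close>; \<open>u\<close> is the
    number of choices.\<close>
  define u where "u = (if z < y then t else Suc t)"
  have u: "(s, y) \<le> (t, z) \<longleftrightarrow> s < u" for s
    by (auto simp: u_def)
  have eq: "?B (w @ [y]) t z = (\<Union>s<u. (\<lambda>l. l @ [(s, y)]) ` ?B w s y)"
  proof (intro equalityI subsetI)
    fix l assume l: "l \<in> ?B (w @ [y]) t z"
    then have "map snd l = w @ [y]" by simp
    then obtain l' s where l': "l = l' @ [(s, y)]" "map snd l' = w"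
      by (cases l rule: rev_cases) auto
    with l have "sorted (l' @ [(s, y)])" "(s, y) \<le> (t, z)"
      by (auto simp: sorted_append)
    with l' u show "l \<in> (\<Union>s<u. (\<lambda>l. l @ [(s, y)]) ` ?B w s y)" by auto
  next
    fix l assume "l \<in> (\<Union>s<u. (\<lambda>l. l @ [(s, y)]) ` ?B w s y)"
    then obtain s l' where s: "(s, y) \<le> (t, z)" and l: "l = l' @ [(s, y)]"
      and l': "sorted (l' @ [(s, y)])" "map snd l' = w"
      using u by auto
    have "\<forall>x\<in>set l'. x \<le> (t, z)"
      using l' s by (auto simp: sorted_append simp del: less_eq_prod_simp intro: order_trans)
    then show "l \<in> ?B (w @ [y]) t z"
      using l l' s by (auto simp: sorted_append simp del: less_eq_prod_simp)
  qed
  have "card (?B (w @ [y]) t z) = (\<Sum>s<u. card ((\<lambda>l. l @ [(s, y)]) ` ?B w s y))"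
    unfolding eq using snoc.IH by (intro card_UN_disjoint) auto
  also have "\<dots> = (\<Sum>s<u. (s + (length w - descents w y)) choose length w)"
    using snoc.IH by (intro sum.cong refl) (subst card_image, auto simp: inj_on_def)
  also have "\<dots> = (u + (length w - descents w y)) choose Suc (length w)"
    by (rule sum_choose_shift) simp
  \<comment> \<open>A final descent cancels the added letter; otherwise the added letter is the
    extra 1 in \<open>u\<close>. The bound on \<open>descents\<close> keeps the subtraction
    exact.\<close>
  also have "u + (length w - descents w y)
      = t + (length (w @ [y]) - descents (w @ [y]) z)"
    using descents_le_length[of w y] by (auto simp: u_def)
  finally show ?case
    unfolding eq using snoc.IH by auto
qed

section \<open>The product formula for colored words\<close>

text \<open>With the color as first component, \<open>letter_less\<close> becomes the lexicographic
  order on pairs, so the results on \<open>descents\<close> apply.\<close>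

lemma des_eq_descents: "des n w = descents (map prod.swap w) (1, n + 1)"
proof -
  have swap_less: "letter_less a b \<longleftrightarrow> prod.swap a < prod.swap b" for a b
    by (cases a; cases b) (auto simp: letter_less_def)
  have "(map prod.swap w @ [(1, n + 1)]) ! j = prod.swap ((w @ [(n + 1, 1)]) ! j)"
    if "j \<le> length w" for j
    using that by (auto simp: nth_append)
  then have "{j. j < length w \<and> letter_less ((w @ [(n + 1, 1)]) ! (j + 1)) ((w @ [(n + 1, 1)]) ! j)}
    = {j. j < length w \<and>
        (map prod.swap w @ [(1, n + 1)]) ! Suc j < (map prod.swap w @ [(1, n + 1)]) ! j}"
    using swap_less by auto
  then show ?thesis by (simp add: des_def descents_def)
qed

lemma des_le_length: "des n w \<le> length w"
  using descents_le_length[of "map prod.swap w"] by (simp add: des_eq_descents)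

text \<open>The letter counts add up to the length. In this form membership depends only on the
  multiset of letters.\<close>

lemma colored_multiset_perms_alt:
  "w \<in> colored_multiset_perms n m r \<longleftrightarrow>
    (\<forall>k\<in>{1..n}. count_list (map fst w) k = m k) \<and>
    (\<forall>(k, c)\<in>set w. k \<in> {1..n} \<and> 1 \<le> c \<and> c \<le> r k)"
proof -
  have "length w = (\<Sum>k=1..n. m k)"
    if "\<forall>k\<in>{1..n}. count_list (map fst w) k = m k" "\<forall>(k, c)\<in>set w. k \<in> {1..n}"
  proof -
    have "(\<Sum>k=1..n. count_list (map fst w) k) = length (map fst w)"
      using that by (intro sum_count_set) auto
    with that show ?thesis by simp
  qed
  then show ?thesis by (auto simp: colored_multiset_perms_def)
qed

text \<open>Double counting of sorted lists of triples (block, color, letter) bounded by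
  \<open>(t, 1, n + 1)\<close>: by the word that remains when blocks are forgotten, and by the
  number of triples with each letter.\<close>

lemma sum_choose_des:
  fixes m r :: "nat \<Rightarrow> nat"
  assumes r: "\<And>k. k \<in> {1..n} \<Longrightarrow> r k > 0"
  defines "N \<equiv> \<Sum>k=1..n. m k"
  shows "(\<Sum>w\<in>colored_multiset_perms n m r. (t + (N - des n w)) choose N)
    = (\<Prod>k=1..n. (r k * t + m k) choose m k)"
proof -
  let ?z = "(t, 1::nat, n + 1)" and ?W = "colored_multiset_perms n m r"
  define B where "B w = {l :: (nat \<times> nat \<times> nat) list. sorted (l @ [?z]) \<and> map snd l = map prod.swap w}" for w
  define f :: "nat \<times> nat \<times> nat \<Rightarrow> nat" where "f = (\<lambda>x. snd (snd x))"
  \<comment> \<open>The triples below \<open>?z\<close>: since \<open>k < n + 1\<close>, block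
    \<open>t\<close> admits exactly color 1. Hence there are \<open>r k * t + 1\<close> triples for
    each letter \<open>k\<close>.\<close>
  define X where "X = {(b, c, k). k \<in> {1..n} \<and> 1 \<le> c \<and> c \<le> r k \<and> (b < t \<or> b = t \<and> c = 1)}"
  define P where "P M \<longleftrightarrow> (\<forall>x\<in>#M. x \<in> X \<and> f x \<in> {1..n}) \<and>
    (\<forall>k\<in>{1..n}. size (filter_mset (\<lambda>x. f x = k) M) = m k)" for M
  have X_key: "{x \<in> X. f x = k} = insert (t, 1, k) ({..<t} \<times> {1..r k} \<times> {k})"
    if "k \<in> {1..n}" for k
    using that r[OF that] by (auto simp: X_def f_def)
  have "X \<subseteq> {..t} \<times> (\<Union>k\<in>{1..n}. {1..r k}) \<times> {1..n}"
    by (auto simp: X_def)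
  then have finite_X: "finite X" by (rule finite_subset) simp
  have card_X_key: "card {x \<in> X. f x = k} = Suc (r k * t)" if "k \<in> {1..n}" for k
    unfolding X_key[OF that] by (subst card_insert_disjoint) (auto simp: card_cartesian_product)

  have count_key: "count_list (map f l) k = size (filter_mset (\<lambda>x. f x = k) (mset l))" for l k
    by (induction l) auto
  \<comment> \<open>The bound by \<open>?z\<close> and the word condition together depend only on
    the multiset of triples, so sorted lists can be traded for multisets.\<close>
  have word_iff: "sorted (l @ [?z]) \<and> map (prod.swap \<circ> snd) l \<in> ?W \<longleftrightarrow> sorted l \<and> P (mset l)" for l
  proof -
    have fst_word: "map fst (map (prod.swap \<circ> snd) l) = map f l"
      by (auto simp: f_def)
    have "map (prod.swap \<circ> snd) l \<in> ?W \<longleftrightarrow>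
      (\<forall>k\<in>{1..n}. size (filter_mset (\<lambda>x. f x = k) (mset l)) = m k) \<and>
      (\<forall>(b, c, k)\<in>set l. k \<in> {1..n} \<and> 1 \<le> c \<and> c \<le> r k)"
      unfolding colored_multiset_perms_alt fst_word count_key by (simp add: case_prod_unfold)
    moreover have "sorted (l @ [?z]) \<longleftrightarrow> sorted l \<and> (\<forall>x\<in>set l. x \<le> ?z)"
      by (simp add: sorted_append del: less_eq_prod_simp)
    moreover have X_iff: "x \<in> X \<and> f x \<in> {1..n} \<longleftrightarrow>
      x \<le> ?z \<and> (case x of (b, c, k) \<Rightarrow> k \<in> {1..n} \<and> 1 \<le> c \<and> c \<le> r k)" for x
      by (cases x) (auto simp: X_def f_def)
    ultimately show ?thesis
      unfolding P_def set_mset_mset X_iff ball_conj_distrib by argo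
  qed
  have B_iff: "l \<in> B w \<longleftrightarrow> sorted (l @ [?z]) \<and> map (prod.swap \<circ> snd) l = w" for l w
  proof -
    have "map snd l = map prod.swap w \<longleftrightarrow> map prod.swap (map snd l) = map prod.swap (map prod.swap w)"
      by (subst inj_map_eq_map) auto
    then show ?thesis by (simp add: B_def)
  qed
  have length_W: "length w = N" if "w \<in> ?W" for w
    using that by (simp add: colored_multiset_perms_def N_def)

  have "(\<Sum>w\<in>?W. (t + (N - des n w)) choose N) = (\<Sum>w\<in>?W. card (B w))"
  proof (rule sum.cong[OF refl])
    fix w assume "w \<in> ?W"
    then show "(t + (N - des n w)) choose N = card (B w)"
      using card_sorted_labellings[of t "(1, n + 1)" "map prod.swap w"] length_W
      by (simp add: B_def des_eq_descents)
  qed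
  also have "\<dots> = card (\<Union>w\<in>?W. B w)"
  proof (rule card_UN_disjoint[symmetric])
    show "\<forall>w\<in>?W. finite (B w)"
      unfolding B_def by (intro ballI card_sorted_labellings[THEN conjunct1])
    show "\<forall>v\<in>?W. \<forall>w\<in>?W. v \<noteq> w \<longrightarrow> B v \<inter> B w = {}"
      by (auto simp only: B_iff disjoint_iff)
  qed (rule finite_colored_multiset_perms)
  also have "(\<Union>w\<in>?W. B w) = {l. sorted l \<and> P (mset l)}"
    by (auto simp only: B_iff UN_iff mem_Collect_eq word_iff[symmetric])
  also have "card \<dots> = card {M. P M}" by (rule card_sorted_lists)
  also have "\<dots> = (\<Prod>k=1..n. (card {x \<in> X. f x = k} + m k - 1) choose m k)"
    unfolding P_def by (rule card_multisets_by_key) (use finite_X in auto)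
  also have "\<dots> = (\<Prod>k=1..n. (r k * t + m k) choose m k)"
    by (rule prod.cong) (simp_all add: card_X_key)
  finally show ?thesis .
qed

section \<open>Reciprocity at negative arguments\<close>

text \<open>The witness is the falling factorial divided by \<open>fact k\<close>. It allows
  identities known on the naturals to be evaluated at negative numbers.\<close>

lemma gbinomial_linear_poly:
  fixes a b :: "'a::field_char_0"
  shows "\<exists>p. \<forall>x. poly p x = (a * x + b) gchoose k"
proof
  show "\<forall>x. poly (smult (1 / fact k) (\<Prod>i = 0..<k. [:b - of_nat i, a:])) x = (a * x + b) gchoose k"
    by (auto simp: gbinomial_prod_rev poly_prod algebra_simps intro!: prod.cong)
qed

lemma poly_eq_if_eq_on_nat:
  fixes p q :: "'a::{idom,ring_char_0} poly"
  assumes "\<And>t. poly p (of_nat t) = poly q (of_nat t)"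
  shows "p = q"
proof (rule ccontr)
  assume "p \<noteq> q"
  then have "finite {x. poly (p - q) x = 0}" by (intro poly_roots_finite) simp
  moreover have "range of_nat \<subseteq> {x. poly (p - q) x = 0}" using assms by auto
  ultimately have "finite (range (of_nat :: nat \<Rightarrow> 'a))" by (rule finite_subset[rotated])
  then show False by (simp add: range_inj_infinite inj_of_nat)
qed

text \<open>Both sides of \<open>sum_choose_des\<close> are polynomials in \<open>t\<close>; this is their value at \<open>- t\<close>.\<close>

lemma sum_choose_des_reciprocal:
  fixes m r :: "nat \<Rightarrow> nat"
  assumes r: "\<And>k. k \<in> {1..n} \<Longrightarrow> r k > 0" and t: "t > 0"
  defines "N \<equiv> \<Sum>k=1..n. m k"
  shows "(\<Sum>w\<in>colored_multiset_perms n m r. (t + des n w - 1) choose N)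
    = (\<Prod>k=1..n. (r k * t - 1) choose m k)"
proof -
  let ?W = "colored_multiset_perms n m r"
  have des_le: "des n w \<le> N" if "w \<in> ?W" for w
    using that des_le_length[of n w] by (simp add: colored_multiset_perms_def N_def)
  have "\<forall>k. \<exists>p. \<forall>x. poly p x = (real (r k) * x + real (m k)) gchoose m k"
    using gbinomial_linear_poly by blast
  from choice[OF this] obtain p where
    p: "\<And>k x. poly (p k) x = (real (r k) * x + real (m k)) gchoose m k"
    by blast
  have "\<forall>w. \<exists>q. \<forall>x. poly q x = (1 * x + real (N - des n w)) gchoose N"
    using gbinomial_linear_poly by blast
  from choice[OF this] obtain q where
    q: "\<And>w x. poly (q w) x = (x + real (N - des n w)) gchoose N"
    unfolding mult_1 by blast
  have eq: "(\<Sum>w\<in>?W. q w) = (\<Prod>k=1..n. p k)"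
  proof (rule poly_eq_if_eq_on_nat)
    fix s
    have "poly (\<Sum>w\<in>?W. q w) (real s) = real (\<Sum>w\<in>?W. (s + (N - des n w)) choose N)"
      by (simp add: poly_sum q binomial_gbinomial)
    also have "\<dots> = real (\<Prod>k=1..n. (r k * s + m k) choose m k)"
      unfolding N_def using sum_choose_des[OF r] by simp
    also have "\<dots> = poly (\<Prod>k=1..n. p k) (real s)"
      by (simp add: poly_prod p binomial_gbinomial)
    finally show "poly (\<Sum>w\<in>?W. q w) (of_nat s) = poly (\<Prod>k=1..n. p k) (of_nat s)" .
  qed
  \<comment> \<open>Upper negation replaces the upper index \<open>x\<close> by
    \<open>N - x - 1\<close>, here \<open>t + des n w - 1\<close>; \<open>t > 0\<close> makes the
    natural subtraction exact.\<close>
  have q_neg: "poly (q w) (- real t) = (- 1) ^ N * real ((t + des n w - 1) choose N)"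
    if "w \<in> ?W" for w
    unfolding q gbinomial_negated_upper[of "- real t + _"] binomial_gbinomial
    using des_le[OF that] t by (simp add: of_nat_diff algebra_simps)
  have p_neg: "poly (p k) (- real t) = (- 1) ^ m k * real ((r k * t - 1) choose m k)"
    if "k \<in> {1..n}" for k
  proof -
    have "r k * t \<ge> 1" using r[OF that] t by (simp add: Suc_le_eq)
    then show ?thesis
      unfolding p gbinomial_negated_upper[of "_ + real (m k)"] binomial_gbinomial
      by (simp add: of_nat_diff algebra_simps)
  qed
  have "(- 1) ^ N * real (\<Sum>w\<in>?W. (t + des n w - 1) choose N) = poly (\<Sum>w\<in>?W. q w) (- real t)"
    by (simp add: poly_sum q_neg sum_distrib_left)
  also have "\<dots> = (\<Prod>k=1..n. (- 1) ^ m k * real ((r k * t - 1) choose m k))"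
    unfolding eq poly_prod by (rule prod.cong) (simp_all add: p_neg)
  \<comment> \<open>The signs multiply to \<open>(- 1) ^ N\<close> because the \<open>m k\<close>
    sum to \<open>N\<close>; they cancel on both sides.\<close>
  also have "\<dots> = (- 1) ^ N * real (\<Prod>k=1..n. (r k * t - 1) choose m k)"
    by (simp add: prod.distrib N_def power_sum)
  finally show ?thesis
    by (simp del: of_nat_sum of_nat_prod)
qed

section \<open>Recovering coefficients from values\<close>

text \<open>The system is triangular: at \<open>t = s\<close> the terms beyond index
  \<open>s\<close> vanish and the term at \<open>s\<close> has factor 1.\<close>

lemma choose_shifts_independent:
  fixes a b :: "nat \<Rightarrow> nat"
  assumes eq: "\<And>t. (\<Sum>s\<le>N. a s * ((t + (N - s)) choose N)) = (\<Sum>s\<le>N. b s * ((t + (N - s)) choose N))"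
  shows "s \<le> N \<Longrightarrow> a s = b s"
proof (induction s rule: less_induct)
  case (less s)
  have split: "(\<Sum>j\<le>N. c j * ((s + (N - j)) choose N))
      = (\<Sum>j<s. c j * ((s + (N - j)) choose N)) + c s" for c :: "nat \<Rightarrow> nat"
  proof -
    have "(\<Sum>j\<le>N. c j * ((s + (N - j)) choose N)) = (\<Sum>j\<le>s. c j * ((s + (N - j)) choose N))"
      using less.prems by (intro sum.mono_neutral_right) (auto simp: binomial_eq_0)
    then show ?thesis
      using less.prems by (simp add: lessThan_Suc_atMost[symmetric])
  qed
  have "(\<Sum>j<s. a j * ((s + (N - j)) choose N)) = (\<Sum>j<s. b j * ((s + (N - j)) choose N))"
    using less by (intro sum.cong) auto
  with eq[of s] show ?case unfolding split by linarith
qed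

lemma coeff_colored_eulerian_poly:
  "coeff (colored_eulerian_poly n m r) s
    = int (card {w \<in> colored_multiset_perms n m r. des n w = s})"
  using sum.inter_filter[OF finite_colored_multiset_perms,
      of "\<lambda>_. 1 :: int" n m r "\<lambda>w. des n w = s"]
  by (simp add: colored_eulerian_poly_def coeff_sum)

text \<open>For \<open>0 < k < n\<close> Pascal's rule gives a sum of two positive numbers.\<close>

lemma choose_eq_1_imp_eq:
  assumes "n choose k = 1" "0 < k" "k \<le> n"
  shows "k = n"
proof (rule ccontr)
  assume "k \<noteq> n"
  with assms obtain n' k' where "n = Suc n'" "k = Suc k'" "Suc k' \<le> n'"
    by (cases n; cases k) auto
  moreover from this have "n' choose k' \<noteq> 0" "n' choose Suc k' \<noteq> 0"
    unfolding binomial_eq_0_iff by simp_all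
  ultimately have "n choose k > 1"
    by (simp only: binomial_Suc_Suc)
  with assms(1) show False by simp
qed

lemma ceiling_divide_le_iff:
  assumes "b > 0"
  shows "\<lceil>real a / real b\<rceil> \<le> int t \<longleftrightarrow> a \<le> b * t"
proof -
  have "\<lceil>real a / real b\<rceil> \<le> int t \<longleftrightarrow> real a \<le> real (b * t)"
    using assms by (simp add: ceiling_le_iff divide_le_eq mult.commute)
  then show ?thesis by (simp only: of_nat_le_iff)
qed

section \<open>The symmetry criterion\<close>

theorem theorem16:
  fixes n :: nat and m r :: "nat \<Rightarrow> nat"
  assumes "n \<ge> 1"
    and "\<And>k. k \<in> {1..n} \<Longrightarrow> m k > 0"
    and "\<And>k. k \<in> {1..n} \<Longrightarrow> r k > 0"
  shows "symmetric_wrt (degree (colored_eulerian_poly n m r)) (colored_eulerian_poly n m r) \<longleftrightarrow>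
    (\<forall>j\<in>{1..n}. (MAX k\<in>{1..n}. \<lceil>real (m k + 1) / real (r k)\<rceil>) * int (r j) = int (m j + 1))"
proof -
  let ?A = "colored_eulerian_poly n m r" and ?W = "colored_multiset_perms n m r"
  let ?M = "MAX k\<in>{1..n}. \<lceil>real (m k + 1) / real (r k)\<rceil>"
  define N where "N = (\<Sum>k=1..n. m k)"
  define a where "a s = card {w \<in> ?W. des n w = s}" for s
  define d where "d = degree ?A"
  have coeff_A: "coeff ?A s = int (a s)" for s
    by (simp add: coeff_colored_eulerian_poly a_def)
  have des_le: "des n w \<le> N" if "w \<in> ?W" for w
    using that des_le_length[of n w] by (simp add: colored_multiset_perms_def N_def)
  have sum_des: "(\<Sum>w\<in>?W. g (des n w)) = (\<Sum>s\<le>N. a s * g s)" for g :: "nat \<Rightarrow> nat"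
  proof -
    have "(\<Sum>w\<in>?W. g (des n w)) = (\<Sum>s\<le>N. \<Sum>w | w \<in> ?W \<and> des n w = s. g (des n w))"
      using des_le by (intro sum.group[symmetric] finite_colored_multiset_perms) auto
    also have "\<dots> = (\<Sum>s\<le>N. a s * g s)"
      by (intro sum.cong) (auto simp: a_def)
    finally show ?thesis .
  qed
  have values_nonneg: "(\<Sum>s\<le>N. a s * ((t + (N - s)) choose N)) = (\<Prod>k=1..n. (r k * t + m k) choose m k)" for t
    using sum_des[of "\<lambda>s. (t + (N - s)) choose N"] sum_choose_des[of n r t m] assms(3)
    unfolding N_def by metis
  have values_neg: "(\<Sum>s\<le>N. a s * ((t + s - 1) choose N)) = (\<Prod>k=1..n. (r k * t - 1) choose m k)"
    if "t > 0" for t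
    using sum_des[of "\<lambda>s. (t + s - 1) choose N"] sum_choose_des_reciprocal[of n r t m] assms(3) that
    unfolding N_def by metis

  \<comment> \<open>At \<open>t = 0\<close> only \<open>s = 0\<close> contributes to the sum, and
    every factor of the product is 1.\<close>
  have "a 0 = (\<Sum>s\<le>N. if s = 0 then a s else 0)" by simp
  also have "\<dots> = (\<Sum>s\<le>N. a s * ((0 + (N - s)) choose N))"
    by (intro sum.cong) (auto simp: binomial_eq_0)
  also have "\<dots> = 1"
    unfolding values_nonneg by simp
  finally have a_0: "a 0 = 1" .
  then have "?A \<noteq> 0" using coeff_A[of 0] by auto
  then have a_d: "a d > 0"
    using coeff_A[of d] leading_coeff_neq_0[of ?A] by (simp add: d_def)
  have a_gt_d: "a s = 0" if "s > d" for s
    using that coeff_A[of s] by (simp add: d_def coeff_eq_0)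
  from a_d obtain w where "w \<in> ?W" "des n w = d"
    unfolding a_def by (metis (mono_tags, lifting) card_gt_0_iff ex_in_conv mem_Collect_eq)
  with des_le have d_le: "d \<le> N" by blast

  \<comment> \<open>The term \<open>(t + s - 1) choose N\<close> is nonzero iff
    \<open>t + s > N\<close>; among \<open>s \<le> d\<close> this first happens for
    \<open>s = d\<close>, at \<open>t = N + 1 - d\<close>.\<close>
  define L where "L = N + 1 - d"
  have L: "L > 0" "N = d + L - 1" using d_le by (auto simp: L_def)
  have sum_upto_d: "(\<Sum>s\<le>N. a s * g s) = (\<Sum>s\<le>d. a s * g s)" for g
    using d_le a_gt_d by (intro sum.mono_neutral_right) auto
  \<comment> \<open>Positivity of the value at \<open>t\<close> is read off twice, from the sum and
    from the product.\<close>
  have L_le_iff: "L \<le> t \<longleftrightarrow> (\<forall>k\<in>{1..n}. m k + 1 \<le> r k * t)" if "t > 0" for t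
  proof -
    have "L \<le> t \<longleftrightarrow> (\<Sum>s\<le>d. a s * ((t + s - 1) choose N)) > 0"
    proof
      assume "L \<le> t"
      then have "a d * ((t + d - 1) choose N) > 0" using a_d L by simp
      moreover have "\<dots> \<le> (\<Sum>s\<le>d. a s * ((t + s - 1) choose N))"
        by (rule member_le_sum) auto
      ultimately show "(\<Sum>s\<le>d. a s * ((t + s - 1) choose N)) > 0" by linarith
    next
      assume "(\<Sum>s\<le>d. a s * ((t + s - 1) choose N)) > 0"
      then obtain s where "s \<le> d" "(t + s - 1) choose N \<noteq> 0"
        by (metis (no_types, lifting) atMost_iff less_irrefl mult_0_right sum.neutral)
      then show "L \<le> t" using L that by simp
    qed
    also have "\<dots> \<longleftrightarrow> (\<Prod>k=1..n. (r k * t - 1) choose m k) > 0"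
      using sum_upto_d values_neg[OF that] by simp
    also have "\<dots> \<longleftrightarrow> (\<forall>k\<in>{1..n}. m k + 1 \<le> r k * t)"
      by (auto simp: prod_pos_nat_iff Suc_le_eq le_diff_conv2 assms(3) that
        intro!: ball_cong)
    finally show ?thesis .
  qed
  have L_bound: "m k + 1 \<le> r k * L" if "k \<in> {1..n}" for k
    using L_le_iff[of L] L that by blast

  have Max_le_iff': "?M \<le> int t \<longleftrightarrow> (\<forall>k\<in>{1..n}. m k + 1 \<le> r k * t)" for t
  proof -
    have "?M \<le> int t \<longleftrightarrow> (\<forall>k\<in>{1..n}. \<lceil>real (m k + 1) / real (r k)\<rceil> \<le> int t)"
      using assms(1) by (subst Max_le_iff) auto
    then show ?thesis
      using ceiling_divide_le_iff[OF assms(3), of _ "m _ + 1" t] by auto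
  qed
  have M_eq: "?M = int L"
  proof (rule antisym)
    show "?M \<le> int L" using Max_le_iff' L_bound by blast
    \<comment> \<open>\<open>L_le_iff\<close> applies only to positive arguments, so
      \<open>?M\<close> must first be shown positive.\<close>
    have "\<not> ?M \<le> int 0" unfolding Max_le_iff' using assms(1) by auto
    then have "nat ?M > 0" and int_nat: "int (nat ?M) = ?M" by auto
    then have "L \<le> nat ?M" using L_le_iff[of "nat ?M"] Max_le_iff'[of "nat ?M"] by simp
    then show "int L \<le> ?M" using int_nat by linarith
  qed

  \<comment> \<open>At \<open>t = L\<close> only the term \<open>s = d\<close> survives, with factor
    \<open>N choose N\<close>.\<close>
  have "a d = (\<Sum>s\<le>d. if s = d then a s else 0)" by simp
  also have "\<dots> = (\<Sum>s\<le>d. a s * ((L + s - 1) choose N))"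
    using L by (intro sum.cong) (auto simp: binomial_eq_0 add.commute)
  also have "\<dots> = (\<Prod>k=1..n. (r k * L - 1) choose m k)"
    using sum_upto_d values_neg L(1) by simp
  finally have a_d_eq: "a d = (\<Prod>k=1..n. (r k * L - 1) choose m k)" .

  have "(\<forall>s\<le>d. a s = a (d - s)) \<longleftrightarrow> (\<forall>j\<in>{1..n}. L * r j = m j + 1)"
  proof
    assume "\<forall>s\<le>d. a s = a (d - s)"
    \<comment> \<open>Symmetry at \<open>s = d\<close> gives \<open>a d = a 0 = 1\<close>, so each
      natural factor is 1.\<close>
    then have "(\<Prod>k=1..n. (r k * L - 1) choose m k) = 1"
      using a_d_eq a_0 by (metis diff_zero zero_le)
    then have one: "(r k * L - 1) choose m k = 1" if "k \<in> {1..n}" for k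
      using that by (subst (asm) prod_eq_1_iff) auto
    show "\<forall>j\<in>{1..n}. L * r j = m j + 1"
    proof
      fix j assume j: "j \<in> {1..n}"
      show "L * r j = m j + 1"
        using choose_eq_1_imp_eq[OF one[OF j] assms(2)[OF j]] L_bound[OF j]
        unfolding mult.commute[of L] by linarith
    qed
  next
    assume *: "\<forall>j\<in>{1..n}. L * r j = m j + 1"
    \<comment> \<open>The reversed coefficients, padded with zeros up to \<open>N\<close> to fit
      \<open>choose_shifts_independent\<close>.\<close>
    define b where "b s = (if s \<le> d then a (d - s) else 0)" for s
    have "(\<Sum>s\<le>N. a s * ((t + (N - s)) choose N)) = (\<Sum>s\<le>N. b s * ((t + (N - s)) choose N))" for t
    proof -
      \<comment> \<open>By the equations \<open>*\<close>, the product at \<open>t\<close> is the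
        reciprocal product at \<open>t + L\<close>.\<close>
      have "(\<Sum>s\<le>N. a s * ((t + (N - s)) choose N)) = (\<Prod>k=1..n. (r k * (t + L) - 1) choose m k)"
        unfolding values_nonneg
      proof (rule prod.cong[OF refl])
        fix k assume "k \<in> {1..n}"
        then have "r k * (t + L) - 1 = r k * t + m k"
          using * by (simp add: distrib_left mult.commute)
        then show "(r k * t + m k) choose m k = (r k * (t + L) - 1) choose m k" by simp
      qed
      also have "\<dots> = (\<Sum>s\<le>d. a s * ((t + L + s - 1) choose N))"
        using values_neg[of "t + L"] sum_upto_d L(1) by simp
      \<comment> \<open>Reversing \<open>s\<close> to \<open>d - s\<close> works because
        \<open>L + d - 1 = N\<close>.\<close>
      also have "\<dots> = (\<Sum>s\<le>d. b s * ((t + (N - s)) choose N))"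
        using L by (intro sum.reindex_bij_witness[of _ "\<lambda>s. d - s" "\<lambda>s. d - s"]) (auto simp: b_def add.assoc)
      also have "\<dots> = (\<Sum>s\<le>N. b s * ((t + (N - s)) choose N))"
        using d_le by (intro sum.mono_neutral_left) (auto simp: b_def)
      finally show ?thesis .
    qed
    then have a_eq_b: "a s = b s" if "s \<le> N" for s
      using that by (rule choose_shifts_independent)
    show "\<forall>s\<le>d. a s = a (d - s)"
    proof (intro allI impI)
      fix s assume "s \<le> d"
      then have "b s = a (d - s)" by (simp add: b_def)
      with a_eq_b[of s] \<open>s \<le> d\<close> d_le show "a s = a (d - s)" by linarith
    qed
  qed
  moreover have "symmetric_wrt (degree ?A) ?A \<longleftrightarrow> (\<forall>s\<le>d. a s = a (d - s))"
    unfolding symmetric_wrt_def coeff_A d_def[symmetric] of_nat_eq_iff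
    by (simp only: order_refl simp_thms Ball_def atLeastAtMost_iff le0)
  moreover have "int L * int (r j) = int (m j + 1) \<longleftrightarrow> L * r j = m j + 1" for j
    by (metis of_nat_eq_iff of_nat_mult)
  ultimately show ?thesis unfolding M_eq by (simp only:)
qed

end
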